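(* For integers $k \geq 0$ define the formal power series (equivalently, functions of $q$ with $|q|<1$) $$ {\rm MU}_{k}(q):=\sum_{m \geq 0} \frac{m^kq^m}{(q;q)_m^2} $$ (with the convention $0^0=1$), and for $k \geq 1$ and $n \geq 1$ let $$ S_{k-1,n}(q):=\sum_{m \geq 1} \frac{m^{k-1}q^{nm}}{1-q^m}. $$ Let $\mathbb{B}_{k,n}:= \mathbb{B}_{k}\left(S_{0,n}, \dots, S_{k-1,n}\right)$, where $\mathbb{B}_k(a_1,\dots,a_k)$ are the complete Bell polynomials. Then for all $k\ge0$, $$ {\rm MU}_{k}(q) = \frac{1}{(q;q)_{\infty}^2}\sum_{n \geq 0} (-1)^{n}q^{\frac{n(n+1)}{2}}\mathbb{B}_{k,n+1}. $$
   Context: $(a;q)_m:=\prod_{j=0}^{m-1}(1-aq^j)$ for $m\in\mathbb{N}_0\cup\{\infty\}$. The complete Bell polynomials $\mathbb{B}_k=\mathbb{B}_k(a_1,\dots,a_k)$ are defined by the generating function identity $\sum_{k \geq 0} \frac{\mathbb{B}_k}{k!}u^k=\exp\left(\sum_{k \geq 1} \frac{a_k}{k!}u^k\right)$; in particular $\mathbb{B}_0=1$. *)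

theory Defs
  imports "HOL-Analysis.Analysis" "HOL-Computational_Algebra.Formal_Power_Series"
    "HOL-Real_Asymp.Real_Asymp"
begin

definition qpochhammer :: "complex \<Rightarrow> complex \<Rightarrow> enat \<Rightarrow> complex" where
  "qpochhammer a q m =
     (case m of enat n \<Rightarrow> (\<Prod>j<n. 1 - a * q ^ j) | \<infinity> \<Rightarrow> (\<Prod>j. 1 - a * q ^ j))"

text \<open>The value \<open>a 0\<close> is ignored; by \<open>complete_bell_cong\<close> below, \<open>complete_bell k a\<close>
  depends on \<open>a 1, \<dots>, a k\<close> only.\<close>

definition complete_bell :: "nat \<Rightarrow> (nat \<Rightarrow> 'a::field_char_0) \<Rightarrow> 'a" where
  "complete_bell k a =
     fact k * fps_nth (fps_exp 1 oo Abs_fps (\<lambda>j. if j = 0 then 0 else a j / fact j)) k"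

definition MU :: "nat \<Rightarrow> complex \<Rightarrow> complex" where
  "MU k q = (\<Sum>\<^sub>\<infinity>m. of_nat m ^ k * q ^ m / qpochhammer q q (enat m) ^ 2)"

definition S :: "nat \<Rightarrow> nat \<Rightarrow> complex \<Rightarrow> complex" where
  "S j n q = (\<Sum>\<^sub>\<infinity>m\<in>{1..}. of_nat m ^ j * q ^ (n * m) / (1 - q ^ m))"

definition bell_S :: "nat \<Rightarrow> nat \<Rightarrow> complex \<Rightarrow> complex" where
  "bell_S k n q = complete_bell k (\<lambda>j. S (j - 1) n q)"

lemma complete_bell_gen_fun:
  "Abs_fps (\<lambda>k. complete_bell k a / fact k) =
     fps_exp 1 oo Abs_fps (\<lambda>j. if j = 0 then 0 else a j / fact j)"
  by (rule fps_ext) (simp add: complete_bell_def)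

lemma complete_bell_0: "complete_bell 0 a = 1"
  by (simp add: complete_bell_def)

lemma fps_power_nth_cong:
  assumes "\<And>j. j \<le> k \<Longrightarrow> fps_nth f j = fps_nth g j" "n \<le> k"
  shows "fps_nth (f ^ i) n = fps_nth ((g :: 'a::comm_ring_1 fps) ^ i) n"
  using assms(2)
proof (induction i arbitrary: n)
  case (Suc i)
  then show ?case by (auto simp: fps_mult_nth assms(1) intro!: sum.cong)
qed simp

lemma complete_bell_cong:
  assumes "\<And>j. 1 \<le> j \<Longrightarrow> j \<le> k \<Longrightarrow> a j = b j"
  shows "complete_bell k a = complete_bell k b"
  unfolding complete_bell_def fps_compose_nth
  by (intro arg_cong2[where f = "(*)"] sum.cong refl fps_power_nth_cong[of k])
     (use assms in auto)

text \<open>For \<open>norm q < 1\<close> all the infinite sums and products involved converge (absolutely),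
  so that none of the above takes a default value.\<close>

lemma one_minus_power_bound:
  fixes q :: complex
  assumes "norm q < 1" "m \<ge> 1"
  shows "1 - norm q \<le> norm (1 - q ^ m)"
proof -
  have "norm q ^ m \<le> norm q"
    using power_decreasing[of 1 m "norm q"] assms by simp
  moreover have "1 - norm q ^ m \<le> norm (1 - q ^ m)"
    using norm_triangle_ineq2[of 1 "q ^ m"] by (simp add: norm_power)
  ultimately show ?thesis by simp
qed

lemma summable_power_geometric:
  fixes r :: real
  assumes "0 \<le> r" "r < 1"
  shows "summable (\<lambda>m. real m ^ j * r ^ m)"
proof (cases "r = 0")
  case True
  have "summable (\<lambda>m. real m ^ j * 0 ^ m)"
    by (rule summable_finite[of "{0}"]) auto
  with True show ?thesis by simp
next
  case False
  define s where "s = sqrt r"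
  have s: "0 < s" "s < 1" "r = s * s" using assms False by (auto simp: s_def)
  have "(\<lambda>m. real m ^ j * s ^ m) \<longlonglongrightarrow> 0"
    using s by real_asymp
  hence "eventually (\<lambda>m. real m ^ j * s ^ m < 1) sequentially"
    by (rule order_tendstoD) simp
  hence "eventually (\<lambda>m. norm (real m ^ j * r ^ m) \<le> s ^ m) sequentially"
  proof eventually_elim
    case (elim m)
    have "real m ^ j * r ^ m = (real m ^ j * s ^ m) * s ^ m"
      by (simp add: s power_mult_distrib)
    also have "\<dots> \<le> 1 * s ^ m"
      using elim s by (intro mult_right_mono) auto
    finally show ?case using assms by (simp add: abs_mult)
  qed
  thus ?thesis
    by (rule summable_comparison_test_ev) (use s in \<open>simp add: summable_geometric\<close>)
qed

lemma convergent_prod_qpochhammer: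
  fixes a q :: complex
  assumes "norm q < 1"
  shows "convergent_prod (\<lambda>j. 1 - a * q ^ j)"
proof (rule abs_convergent_prod_imp_convergent_prod)
  show "abs_convergent_prod (\<lambda>j. 1 - a * q ^ j)"
    unfolding abs_convergent_prod_conv_summable
    using assms by (simp add: norm_mult norm_power summable_mult summable_geometric)
qed

lemma qpochhammer_infinity_nonzero:
  assumes "norm q < 1"
  shows "qpochhammer q q \<infinity> \<noteq> 0"
proof -
  have "q ^ Suc j \<noteq> 1" for j
    using one_minus_power_bound[of q "Suc j"] assms by auto
  hence "(\<Prod>j. 1 - q * q ^ j) \<noteq> 0"
    using convergent_prod_qpochhammer[OF assms, of q]
    by (intro prodinf_nonzero) auto
  thus ?thesis by (simp add: qpochhammer_def)
qed

lemma summable_S_bound: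
  fixes q :: complex
  assumes "norm q < 1"
  shows "summable (\<lambda>m. real m ^ j * norm q ^ m / (1 - norm q))"
  using summable_power_geometric[of "norm q" j] assms by (intro summable_divide) auto

lemma summable_on_S_bound:
  fixes q :: complex
  assumes "norm q < 1"
  shows "(\<lambda>m. real m ^ j * norm q ^ m / (1 - norm q)) summable_on {1..}"
proof (rule summable_on_subset_banach)
  show "(\<lambda>m. real m ^ j * norm q ^ m / (1 - norm q)) summable_on UNIV"
    using summable_S_bound[OF assms, of j] assms by (intro norm_summable_imp_summable_on) auto
qed auto

lemma S_term_bound:
  fixes q :: complex
  assumes "norm q < 1" "n \<ge> 1" "m \<ge> 1"
  shows "norm (of_nat m ^ j * q ^ (n * m) / (1 - q ^ m)) \<le> real m ^ j * norm q ^ m / (1 - norm q)"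
proof -
  have "norm q ^ (n * m) \<le> norm q ^ m"
    using assms by (intro power_decreasing) auto
  thus ?thesis using one_minus_power_bound[of q m] assms
    by (auto simp: norm_divide norm_mult norm_power intro!: frac_le mult_left_mono)
qed

lemma S_abs_summable:
  fixes q :: complex
  assumes "norm q < 1" "n \<ge> 1"
  shows "(\<lambda>m. norm (of_nat m ^ j * q ^ (n * m) / (1 - q ^ m))) summable_on {1..}"
proof (rule summable_on_comparison_test)
  show "(\<lambda>m. real m ^ j * norm q ^ m / (1 - norm q)) summable_on {1..}"
    by (rule summable_on_S_bound[OF assms(1)])
qed (use assms S_term_bound in auto)

lemma MU_abs_summable:
  assumes "norm q < 1"
  shows "(\<lambda>m. norm (of_nat m ^ k * q ^ m / qpochhammer q q (enat m) ^ 2)) summable_on UNIV"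
proof -
  define P where "P = (\<lambda>m. qpochhammer q q (enat m))"
  have "(\<lambda>m. \<Prod>j\<le>m. 1 - q * q ^ j) \<longlonglongrightarrow> (\<Prod>j. 1 - q * q ^ j)"
    using convergent_prod_qpochhammer[OF assms] by (rule convergent_prod_LIMSEQ)
  hence "(\<lambda>m. P (Suc m)) \<longlonglongrightarrow> qpochhammer q q \<infinity>"
    by (simp add: P_def qpochhammer_def lessThan_Suc_atMost)
  hence "P \<longlonglongrightarrow> qpochhammer q q \<infinity>"
    by (rule LIMSEQ_imp_Suc)
  hence "(\<lambda>m. inverse (P m ^ 2)) \<longlonglongrightarrow> inverse (qpochhammer q q \<infinity> ^ 2)"
    using qpochhammer_infinity_nonzero[OF assms] by (intro tendsto_intros) auto
  hence "Bseq (\<lambda>m. inverse (P m ^ 2))"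
    using convergent_imp_Bseq convergentI by blast
  then obtain K where K: "K > 0" "\<forall>m. norm (inverse (P m ^ 2)) \<le> K"
    by (rule BseqE)
  have "summable (\<lambda>m. real m ^ k * norm q ^ m * K)"
    using summable_power_geometric[of "norm q" k] assms by (intro summable_mult2) auto
  hence "(\<lambda>m. real m ^ k * norm q ^ m * K) summable_on UNIV"
    using K(1) by (intro norm_summable_imp_summable_on) auto
  hence "(\<lambda>m. norm (of_nat m ^ k * q ^ m / P m ^ 2)) summable_on UNIV"
  proof (rule summable_on_comparison_test)
    fix m
    have "norm (of_nat m ^ k * q ^ m / P m ^ 2) = real m ^ k * norm q ^ m * norm (inverse (P m ^ 2))"
      by (simp only: norm_mult norm_power norm_of_nat divide_inverse)
    also have "\<dots> \<le> real m ^ k * norm q ^ m * K"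
      using K(2) by (intro mult_left_mono) auto
    finally show "norm (of_nat m ^ k * q ^ m / P m ^ 2) \<le> real m ^ k * norm q ^ m * K" .
  qed (rule norm_ge_zero)
  thus ?thesis
    unfolding P_def .
qed

lemma norm_fps_power_nth_le:
  fixes f :: "complex fps" and g :: "real fps"
  assumes "\<And>n. norm (fps_nth f n) \<le> fps_nth g n"
  shows "norm (fps_nth (f ^ i) n) \<le> fps_nth (g ^ i) n"
proof (induction i arbitrary: n)
  case (Suc i)
  have "norm (fps_nth (f ^ Suc i) n) \<le> (\<Sum>j=0..n. norm (fps_nth f j) * norm (fps_nth (f ^ i) (n - j)))"
    by (simp add: fps_mult_nth flip: norm_mult) (rule norm_sum)
  also have "\<dots> \<le> (\<Sum>j=0..n. fps_nth g j * fps_nth (g ^ i) (n - j))"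
    by (intro sum_mono mult_mono assms Suc.IH norm_ge_zero order.trans[OF norm_ge_zero assms])
  finally show ?case by (simp add: fps_mult_nth)
qed simp

lemma norm_complete_bell_le:
  fixes a :: "nat \<Rightarrow> complex" and b :: "nat \<Rightarrow> real"
  assumes "\<And>j. j \<ge> 1 \<Longrightarrow> norm (a j) \<le> b j"
  shows "norm (complete_bell k a) \<le> complete_bell k b"
proof -
  define f where "f = Abs_fps (\<lambda>j. if j = 0 then 0 else a j / fact j)"
  define g where "g = Abs_fps (\<lambda>j. if j = 0 then 0 else b j / fact j)"
  have "norm (fps_nth f n) \<le> fps_nth g n" for n
    using assms[of n] by (auto simp: f_def g_def norm_divide intro!: divide_right_mono)
  hence fg: "norm (fps_nth (f ^ i) k) \<le> fps_nth (g ^ i) k" for i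
    by (rule norm_fps_power_nth_le)
  have "norm (complete_bell k a) = fact k * norm (\<Sum>i=0..k. 1 / fact i * fps_nth (f ^ i) k)"
    by (simp add: complete_bell_def fps_compose_nth norm_mult flip: f_def)
  also have "\<dots> \<le> fact k * (\<Sum>i=0..k. 1 / fact i * fps_nth (g ^ i) k)"
    by (intro mult_left_mono order.trans[OF norm_sum] sum_mono)
       (use fg in \<open>auto simp: norm_mult norm_divide intro!: divide_right_mono\<close>)
  also have "\<dots> = complete_bell k b"
    by (simp add: complete_bell_def fps_compose_nth flip: g_def)
  finally show ?thesis .
qed

lemma norm_S_le:
  assumes "norm q < 1" "n \<ge> 1"
  shows "norm (S j n q) \<le> (\<Sum>\<^sub>\<infinity>m\<in>{1..}. real m ^ j * norm q ^ m / (1 - norm q))"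
  unfolding S_def
proof (rule order.trans[OF norm_infsum_bound infsum_mono])
  show "(\<lambda>m. norm (of_nat m ^ j * q ^ (n * m) / (1 - q ^ m))) summable_on {1..}"
    by (rule S_abs_summable[OF assms])
  show "(\<lambda>m. norm (of_nat m ^ j * q ^ (n * m) / (1 - q ^ m))) summable_on {1..}"
    by (rule S_abs_summable[OF assms])
  show "(\<lambda>m. real m ^ j * norm q ^ m / (1 - norm q)) summable_on {1..}"
    by (rule summable_on_S_bound[OF assms(1)])
qed (use assms S_term_bound in auto)

lemma bell_sum_abs_summable:
  assumes "norm q < 1"
  shows "(\<lambda>n. norm ((-1) ^ n * q ^ (n * (n + 1) div 2) * bell_S k (n + 1) q)) summable_on UNIV"
proof -
  define c where "c = (\<lambda>j. \<Sum>\<^sub>\<infinity>m\<in>{1..}. real m ^ (j - 1) * norm q ^ m / (1 - norm q))"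
  define K where "K = complete_bell k c"
  have K: "norm (bell_S k (n + 1) q) \<le> K" for n
    unfolding bell_S_def K_def c_def
    by (intro norm_complete_bell_le norm_S_le) (use assms in auto)
  have K0: "0 \<le> K" using order.trans[OF norm_ge_zero K] .
  have le: "norm ((-1) ^ n * q ^ (n * (n + 1) div 2) * bell_S k (n + 1) q) \<le> norm q ^ n * K" for n
  proof -
    have "n \<le> n * (n + 1) div 2" by (cases n) auto
    hence "norm q ^ (n * (n + 1) div 2) \<le> norm q ^ n"
      using assms by (intro power_decreasing) auto
    thus ?thesis using K[of n]
      by (auto simp: norm_mult norm_power intro!: mult_mono)
  qed
  have "summable (\<lambda>n. norm q ^ n * K)"
    using assms by (intro summable_mult2 summable_geometric) auto
  hence "(\<lambda>n. norm q ^ n * K) summable_on UNIV"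
    using K0 by (intro norm_summable_imp_summable_on) auto
  thus ?thesis
    by (rule summable_on_comparison_test) (use le in auto)
qed

end

theory Submission imports Defs
begin

text \<open>With \<open>\<zeta> = exp u\<close>, the Bell numbers \<open>B\<^sub>k\<^sub>,\<^sub>n\<close> have the exponential generating function
  \<open>(q^n; q)\<^sub>\<infinity> / (\<zeta> q^n; q)\<^sub>\<infinity>\<close>, which Euler's identity expands as
  \<open>(q^n; q)\<^sub>\<infinity> (\<Sum>m. \<zeta>^m q^(n m) / (q; q)\<^sub>m)\<close>. Comparing coefficients of \<open>u\<close> gives
  \<open>B\<^sub>k\<^sub>,\<^sub>n = (q^n; q)\<^sub>\<infinity> (\<Sum>m. m^k q^(n m) / (q; q)\<^sub>m)\<close>; instead of working with series in \<open>u\<close>,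
  this is obtained by checking that the right-hand side satisfies the recurrence of the complete
  Bell polynomials. Inserting it into the sum over \<open>n\<close> and exchanging the summations, Euler's
  second identity evaluates the inner sum as \<open>(q^(m+1); q)\<^sub>\<infinity> = (q; q)\<^sub>\<infinity> / (q; q)\<^sub>m\<close>.\<close>

section \<open>Finite and infinite q-Pochhammer symbols\<close>

lemma qpochhammer_0 [simp]: "qpochhammer a q (enat 0) = 1"
  by (simp add: qpochhammer_def)

lemma qpochhammer_Suc: "qpochhammer a q (enat (Suc n)) = qpochhammer a q (enat n) * (1 - a * q ^ n)"
  by (simp add: qpochhammer_def)

lemma qpochhammer_add:
  "qpochhammer a q (enat (n + m)) = qpochhammer a q (enat n) * qpochhammer (a * q ^ n) q (enat m)"
  by (induction m) (simp_all add: qpochhammer_Suc power_add mult.assoc)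

lemma qpochhammer_nonzero:
  assumes "norm q < 1" "norm a < 1"
  shows "qpochhammer a q (enat n) \<noteq> 0"
proof -
  have "a * q ^ j \<noteq> 1" for j
  proof
    assume "a * q ^ j = 1"
    hence "norm a * norm q ^ j = 1" by (metis norm_mult norm_one norm_power)
    moreover have "norm a * norm q ^ j \<le> norm a * 1"
      using assms by (intro mult_left_mono power_le_one) auto
    ultimately show False using assms by simp
  qed
  thus ?thesis by (auto simp: qpochhammer_def)
qed

lemma qpochhammer_LIMSEQ:
  assumes "norm q < 1"
  shows "(\<lambda>n. qpochhammer a q (enat n)) \<longlonglongrightarrow> qpochhammer a q \<infinity>"
proof -
  have "(\<lambda>m. \<Prod>j\<le>m. 1 - a * q ^ j) \<longlonglongrightarrow> (\<Prod>j. 1 - a * q ^ j)"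
    using convergent_prod_qpochhammer[OF assms] by (rule convergent_prod_LIMSEQ)
  hence "(\<lambda>m. qpochhammer a q (enat (Suc m))) \<longlonglongrightarrow> qpochhammer a q \<infinity>"
    by (simp add: qpochhammer_def lessThan_Suc_atMost)
  thus ?thesis by (rule LIMSEQ_imp_Suc)
qed

text \<open>Passes to the limit in \<open>qpochhammer_add\<close>. With \<open>a = q\<close> it
  expresses the tail product starting at \<open>q ^ Suc n\<close> as
  \<open>(q; q)_inf / (q; q)_n\<close>, the form needed for both rows and columns of the final
  double series.\<close>

lemma qpochhammer_infinity_split:
  assumes "norm q < 1"
  shows "qpochhammer a q \<infinity> = qpochhammer a q (enat n) * qpochhammer (a * q ^ n) q \<infinity>"
proof (rule LIMSEQ_unique)
  show "(\<lambda>m. qpochhammer a q (enat (n + m))) \<longlonglongrightarrow> qpochhammer a q \<infinity>"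
    using LIMSEQ_ignore_initial_segment[OF qpochhammer_LIMSEQ[OF assms], of a n]
    by (simp add: add.commute)
  show "(\<lambda>m. qpochhammer a q (enat (n + m))) \<longlonglongrightarrow>
          qpochhammer a q (enat n) * qpochhammer (a * q ^ n) q \<infinity>"
    unfolding qpochhammer_add by (intro tendsto_intros qpochhammer_LIMSEQ assms)
qed

text \<open>The reciprocals converge because the infinite product is nonzero. The resulting uniform
  bound is the constant in the majorants below.\<close>

lemma inverse_qpochhammer_bounded:
  assumes "norm q < 1"
  obtains K where "K > 0" "\<And>m. norm (1 / qpochhammer q q (enat m)) \<le> K"
proof -
  have "(\<lambda>m. 1 / qpochhammer q q (enat m)) \<longlonglongrightarrow> 1 / qpochhammer q q \<infinity>"
    by (intro tendsto_intros qpochhammer_LIMSEQ qpochhammer_infinity_nonzero assms)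
  hence "Bseq (\<lambda>m. 1 / qpochhammer q q (enat m))"
    using convergent_imp_Bseq convergentI by blast
  thus ?thesis using that by (auto elim: BseqE)
qed

section \<open>Euler's two series identities\<close>

lemma power_series_tendsto_geometric:
  fixes f :: "nat \<Rightarrow> complex"
  assumes bd: "\<And>n. norm (f n) \<le> K" and "norm q < 1" "norm x < 1"
  shows "(\<lambda>N. \<Sum>n. f n * (x * q ^ N) ^ n) \<longlonglongrightarrow> f 0"
proof -
  \<comment> \<open>Continuity at 0 only needs convergence at some nonzero point; \<open>1/2\<close>
    is an arbitrary choice inside the unit disc.\<close>
  have "summable (\<lambda>n. f n * (1/2) ^ n)"
  proof (rule summable_comparison_test')
    show "summable (\<lambda>n. K * (1/2) ^ n)" by (intro summable_mult summable_geometric) auto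
    show "norm (f n * (1/2) ^ n) \<le> K * (1/2) ^ n" for n
      using bd[of n] by (simp add: norm_mult norm_power power_divide divide_right_mono norm_divide)
  qed
  hence "isCont (\<lambda>y. \<Sum>n. f n * y ^ n) 0" by (rule isCont_powser) auto
  moreover have "(\<lambda>N. x * q ^ N) \<longlonglongrightarrow> 0"
    using assms by (auto intro!: tendsto_mult_right_zero LIMSEQ_power_zero)
  ultimately have "(\<lambda>N. \<Sum>n. f n * (x * q ^ N) ^ n) \<longlonglongrightarrow> (\<Sum>n. f n * 0 ^ n)"
    by (rule isCont_tendsto_compose)
  thus ?thesis by (simp only: powser_zero)
qed

lemma bounded_power_series_summable:
  fixes f :: "nat \<Rightarrow> complex"
  assumes "\<And>n. norm (f n) \<le> K" "norm x < 1"
  shows "summable (\<lambda>n. f n * x ^ n)"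
proof (rule summable_comparison_test')
  show "summable (\<lambda>n. K * norm x ^ n)" using assms by (intro summable_mult summable_geometric) auto
  show "norm (f n * x ^ n) \<le> K * norm x ^ n" for n
    using assms(1)[of n] by (simp add: norm_mult norm_power mult_right_mono)
qed

text \<open>The coefficient recurrence makes the series \<open>F\<close> satisfy
  \<open>F (y * q) = (1 - y) * F y\<close>. Iterating from \<open>x\<close> and letting
  \<open>x * q ^ N\<close> tend to 0 gives \<open>(x; q)_inf * F x = F 0 = 1\<close>, which also
  shows that the product is nonzero.\<close>

lemma euler_reciprocal_sums:
  assumes q: "norm q < 1" and x: "norm x < 1"
  shows "(\<lambda>n. x ^ n / qpochhammer q q (enat n)) sums (1 / qpochhammer x q \<infinity>)"
    and "qpochhammer x q \<infinity> \<noteq> 0"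
proof -
  define f where "f = (\<lambda>n. 1 / qpochhammer q q (enat n))"
  define F where "F = (\<lambda>y. \<Sum>n. f n * y ^ n)"
  obtain K where K: "norm (f n) \<le> K" for n
    using inverse_qpochhammer_bounded[OF q] unfolding f_def by metis
  note sm = bounded_power_series_summable[OF K]
  have f_Suc: "f (Suc n) * (1 - q ^ Suc n) = f n" for n
    using qpochhammer_nonzero[OF q q, of "Suc n"] by (simp add: f_def qpochhammer_Suc)
  have step: "F (y * q) = (1 - y) * F y" if y: "norm y < 1" for y
  proof -
    have yq: "norm (y * q) < 1"
      using mult_strict_mono'[of "norm y" 1 "norm q" 1] y q by (simp add: norm_mult)
    have 1: "(\<lambda>n. f n * y ^ n - f n * (y * q) ^ n) sums (F y - F (y * q))"
      unfolding F_def by (intro sums_diff summable_sums sm y yq)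
    have "(\<lambda>n. f n * y ^ n * y) sums (F y * y)"
      unfolding F_def by (intro sums_mult2 summable_sums sm y)
    also have "(\<lambda>n. f n * y ^ n * y) = (\<lambda>n. f (Suc n) * y ^ Suc n - f (Suc n) * (y * q) ^ Suc n)"
      by (rule ext, subst f_Suc[symmetric]) (simp add: algebra_simps power_mult_distrib)
    \<comment> \<open>The term at index 0 is \<open>f 0 - f 0 = 0\<close>, so undoing the index
      shift does not change the sum.\<close>
    finally have "(\<lambda>n. f n * y ^ n - f n * (y * q) ^ n) sums (F y * y)"
      by (subst (asm) sums_Suc_iff) simp
    with 1 have "F y - F (y * q) = F y * y" by (rule sums_unique2)
    thus ?thesis by (simp add: algebra_simps)
  qed
  have "F (x * q ^ N) = qpochhammer x q (enat N) * F x" for N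
  proof (induction N)
    case (Suc N)
    have "norm (x * q ^ N) < 1"
      using mult_right_le_one_le[of "norm x" "norm q ^ N"] x q
      by (simp add: norm_mult norm_power power_le_one)
    from step[OF this] Suc show ?case by (simp add: qpochhammer_Suc mult_ac)
  qed simp
  moreover have "(\<lambda>N. F (x * q ^ N)) \<longlonglongrightarrow> 1"
    using power_series_tendsto_geometric[of f K, OF K q x] by (simp add: F_def) (simp add: f_def)
  ultimately have "(\<lambda>N. qpochhammer x q (enat N) * F x) \<longlonglongrightarrow> 1" by simp
  moreover have "(\<lambda>N. qpochhammer x q (enat N) * F x) \<longlonglongrightarrow> qpochhammer x q \<infinity> * F x"
    by (intro tendsto_intros qpochhammer_LIMSEQ q)
  ultimately have eq: "qpochhammer x q \<infinity> * F x = 1" by (rule LIMSEQ_unique[symmetric])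
  thus nz: "qpochhammer x q \<infinity> \<noteq> 0" by auto
  have "(\<lambda>n. f n * x ^ n) sums F x"
    unfolding F_def by (intro summable_sums sm x)
  moreover have "F x = 1 / qpochhammer x q \<infinity>" using eq nz by (simp add: field_simps)
  ultimately show "(\<lambda>n. x ^ n / qpochhammer q q (enat n)) sums (1 / qpochhammer x q \<infinity>)"
    by (simp add: f_def)
qed

text \<open>Same method as for the reciprocal, with the functional equation reversed:
  \<open>G y = (1 - y) * G (y * q)\<close>.\<close>

lemma euler_sums:
  assumes q: "norm q < 1" and x: "norm x < 1"
  shows "(\<lambda>n. (-1) ^ n * q ^ (n * (n - 1) div 2) * x ^ n / qpochhammer q q (enat n))
           sums qpochhammer x q \<infinity>"
proof -
  define g where "g = (\<lambda>n. (-1) ^ n * q ^ (n * (n - 1) div 2) / qpochhammer q q (enat n))"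
  define G where "G = (\<lambda>y. \<Sum>n. g n * y ^ n)"
  obtain K where K0: "norm (1 / qpochhammer q q (enat n)) \<le> K" for n
    using inverse_qpochhammer_bounded[OF q] by metis
  have K: "norm (g n) \<le> K" for n
  proof -
    have "norm (g n) = norm q ^ (n * (n - 1) div 2) * norm (1 / qpochhammer q q (enat n))"
      by (simp add: g_def norm_mult norm_power norm_divide)
    also have "\<dots> \<le> 1 * K"
      using q by (intro mult_mono power_le_one K0) auto
    finally show ?thesis by simp
  qed
  note sm = bounded_power_series_summable[OF K]
  have g_Suc: "g (Suc n) * (1 - q ^ Suc n) = - (q ^ n * g n)" for n
  proof -
    \<comment> \<open>Consecutive triangular exponents differ by \<open>n\<close>, which produces
      the factor \<open>q ^ n\<close> in the recurrence.\<close>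
    have "Suc n * n div 2 = n * (n - 1) div 2 + n"
      by (cases n) auto
    thus ?thesis
      using qpochhammer_nonzero[OF q q, of "Suc n"]
      by (simp add: g_def qpochhammer_Suc power_add)
  qed
  have step: "G y = (1 - y) * G (y * q)" if y: "norm y < 1" for y
  proof -
    have yq: "norm (y * q) < 1"
      using mult_strict_mono'[of "norm y" 1 "norm q" 1] y q by (simp add: norm_mult)
    have 1: "(\<lambda>n. g n * y ^ n - g n * (y * q) ^ n) sums (G y - G (y * q))"
      unfolding G_def by (intro sums_diff summable_sums sm y yq)
    have "(\<lambda>n. g n * (y * q) ^ n * - y) sums (G (y * q) * - y)"
      unfolding G_def by (intro sums_mult2 summable_sums sm yq)
    also have "(\<lambda>n. g n * (y * q) ^ n * - y)
        = (\<lambda>n. g (Suc n) * y ^ Suc n - g (Suc n) * (y * q) ^ Suc n)"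
    proof
      fix n
      have "g (Suc n) * y ^ Suc n - g (Suc n) * (y * q) ^ Suc n
              = (g (Suc n) * (1 - q ^ Suc n)) * y ^ Suc n"
        by (simp add: algebra_simps power_mult_distrib)
      thus "g n * (y * q) ^ n * - y = g (Suc n) * y ^ Suc n - g (Suc n) * (y * q) ^ Suc n"
        unfolding g_Suc by (simp add: algebra_simps power_mult_distrib)
    qed
    finally have "(\<lambda>n. g n * y ^ n - g n * (y * q) ^ n) sums (G (y * q) * - y)"
      by (subst (asm) sums_Suc_iff) simp
    with 1 have "G y - G (y * q) = G (y * q) * - y" by (rule sums_unique2)
    thus ?thesis by (simp add: algebra_simps)
  qed
  have "G x = qpochhammer x q (enat N) * G (x * q ^ N)" for N
  proof (induction N)
    case (Suc N)
    have "norm (x * q ^ N) < 1"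
      using mult_right_le_one_le[of "norm x" "norm q ^ N"] x q
      by (simp add: norm_mult norm_power power_le_one)
    from step[OF this] Suc show ?case by (simp add: qpochhammer_Suc mult_ac)
  qed simp
  moreover have "(\<lambda>N. qpochhammer x q (enat N) * G (x * q ^ N)) \<longlonglongrightarrow> qpochhammer x q \<infinity> * g 0"
    unfolding G_def
    by (intro tendsto_intros qpochhammer_LIMSEQ power_series_tendsto_geometric[OF K] q x)
  \<comment> \<open>The iterated expression does not depend on \<open>N\<close>, so it equals its
    limit; moreover \<open>g 0 = 1\<close>.\<close>
  ultimately have "G x = qpochhammer x q \<infinity> * g 0" by (simp add: LIMSEQ_const_iff)
  moreover have "(\<lambda>n. g n * x ^ n) sums G x"
    unfolding G_def by (intro summable_sums sm x)
  ultimately show ?thesis by (simp add: g_def)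
qed

section \<open>The Bell recurrence and the series that satisfies it\<close>

lemma complete_bell_Suc:
  "complete_bell (Suc k) a = (\<Sum>j\<le>k. of_nat (k choose j) * a (Suc j) * complete_bell (k - j) a)"
proof -
  define A where "A = Abs_fps (\<lambda>j. if j = 0 then 0 else a j / fact j)"
  define E where "E = fps_exp 1 oo A"
  \<comment> \<open>Chain rule, as \<open>fps_exp 1\<close> is its own derivative. The recurrence is
    the comparison of coefficients here.\<close>
  have "fps_deriv E = E * fps_deriv A"
    unfolding E_def by (subst fps_compose_deriv) (simp_all add: A_def)
  hence "fps_nth (fps_deriv E) k = (\<Sum>j=0..k. fps_nth (fps_deriv A) j * fps_nth E (k - j))"
    by (simp add: fps_mult_nth mult.commute[of E])
  hence "of_nat (Suc k) * fps_nth E (Suc k)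
      = (\<Sum>j\<le>k. a (Suc j) / fact j * fps_nth E (k - j))"
    by (simp add: A_def atLeast0AtMost del: of_nat_Suc)
  hence "complete_bell (Suc k) a = fact k * (\<Sum>j\<le>k. a (Suc j) / fact j * fps_nth E (k - j))"
    by (simp add: complete_bell_def mult_ac flip: A_def E_def)
  also have "\<dots> = (\<Sum>j\<le>k. of_nat (k choose j) * a (Suc j) * complete_bell (k - j) a)"
    unfolding sum_distrib_left
    by (intro sum.cong refl)
       (simp add: complete_bell_def binomial_fact flip: A_def E_def)
  finally show ?thesis .
qed

text \<open>The coefficient form of the logarithmic derivative of
  \<open>1 / (x; q)\<^sub>\<infinity> = (\<Sum>m. x ^ m / (q; q)\<^sub>m)\<close>. The summand \<open>i = 0\<close> vanishes because \<open>1 / 0 = 0\<close>.\<close>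

lemma inverse_qpochhammer_log_deriv:
  assumes q: "norm q < 1"
  shows "(\<Sum>i\<le>m. 1 / (1 - q ^ i) * (1 / qpochhammer q q (enat (m - i))))
           = of_nat m / qpochhammer q q (enat m)"
proof -
  define f where "f = (\<lambda>n. 1 / qpochhammer q q (enat n))"
  \<comment> \<open>The index is shifted by one so that every denominator is nonzero.\<close>
  define c where "c = (\<lambda>m. \<Sum>i<m. 1 / (1 - q ^ Suc i) * f (m - Suc i))"
  have nz: "1 - q ^ Suc i \<noteq> 0" for i
    using one_minus_power_bound[OF q, of "Suc i"] q by auto
  have f_Suc: "f (Suc n) * (1 - q ^ Suc n) = f n" for n
    using nz[of n] by (simp add: f_def qpochhammer_Suc)
  have "c m = of_nat m * f m"
  proof (induction m)
    case (Suc m)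
    \<comment> \<open>With \<open>a = q ^ Suc i\<close> and \<open>b = q ^ (m - i)\<close>, so that
      \<open>a * b = q ^ Suc m\<close>, this is
      \<open>(1 - a*b) / (1 - a) = 1 + a / (1 - a) * (1 - b)\<close>, where
      \<open>a / (1 - a) = 1 / (1 - a) - 1\<close>.\<close>
    have expand: "(1 - q ^ Suc m) * (1 / (1 - q ^ Suc i) * f (m - i))
        = f (m - i) + (1 / (1 - q ^ Suc i) - 1) * (f (m - i) * (1 - q ^ (m - i)))"
      if "i \<le> m" for i
    proof -
      have "q ^ Suc m = q ^ Suc i * q ^ (m - i)"
        using that by (simp flip: power_add)
      thus ?thesis using nz[of i] by (simp add: field_simps del: power_Suc)
    qed
    have "(1 - q ^ Suc m) * c (Suc m) =
        (\<Sum>i\<le>m. f (m - i) + (1 / (1 - q ^ Suc i) - 1) * (f (m - i) * (1 - q ^ (m - i))))"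
      unfolding c_def sum_distrib_left lessThan_Suc_atMost
      unfolding diff_Suc_Suc by (intro sum.cong refl expand) (erule atMost_iff[THEN iffD1])
    \<comment> \<open>The summand \<open>i = m\<close> of the second sum drops out because
      \<open>1 - q ^ 0 = 0\<close>.\<close>
    also have "\<dots> = (\<Sum>i\<le>m. f (m - i))
        + (\<Sum>i<m. (1 / (1 - q ^ Suc i) - 1) * (f (m - i) * (1 - q ^ (m - i))))"
      by (simp add: sum.distrib flip: lessThan_Suc_atMost del: power_Suc)
    also have "(\<Sum>i<m. (1 / (1 - q ^ Suc i) - 1) * (f (m - i) * (1 - q ^ (m - i))))
        = (\<Sum>i<m. (1 / (1 - q ^ Suc i) - 1) * f (m - Suc i))"
      by (intro sum.cong refl) (metis f_Suc Suc_diff_Suc lessThan_iff)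
    also have "\<dots> = c m - (\<Sum>i<m. f (m - Suc i))"
      by (simp add: c_def left_diff_distrib sum_subtractf)
    \<comment> \<open>The two sums of \<open>f\<close> now cancel up to \<open>f m\<close>, and the
      induction hypothesis turns \<open>c m + f m\<close> into
      \<open>of_nat (Suc m) * f m\<close>.\<close>
    also have "(\<Sum>i\<le>m. f (m - i)) = f m + (\<Sum>i<m. f (m - Suc i))"
      unfolding lessThan_Suc_atMost[symmetric] by (subst sum.lessThan_Suc_shift) simp
    finally have "(1 - q ^ Suc m) * c (Suc m) = of_nat (Suc m) * f m"
      by (simp add: Suc algebra_simps)
    hence "(1 - q ^ Suc m) * c (Suc m) = (1 - q ^ Suc m) * (of_nat (Suc m) * f (Suc m))"
      using f_Suc[of m] by (simp add: mult_ac)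
    thus ?case using nz[of m] by simp
  qed (simp add: c_def)
  moreover have "(\<Sum>i\<le>m. 1 / (1 - q ^ i) * f (m - i)) = c m"
    unfolding c_def lessThan_Suc_atMost[symmetric] by (subst sum.lessThan_Suc_shift) simp
  ultimately show ?thesis by (simp add: f_def)
qed

lemma summable_norm_power_qpochhammer:
  assumes q: "norm q < 1" and x: "norm x < 1"
  shows "summable (\<lambda>m. norm (of_nat m ^ k * x ^ m / qpochhammer q q (enat m)))"
proof -
  obtain K where K: "K > 0" "\<And>m. norm (1 / qpochhammer q q (enat m)) \<le> K"
    using inverse_qpochhammer_bounded[OF q] by metis
  show ?thesis
  proof (rule summable_comparison_test')
    show "summable (\<lambda>m. real m ^ k * norm x ^ m * K)"
      using summable_power_geometric[of "norm x" k] x by (intro summable_mult2) auto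
    fix m
    have "norm (of_nat m ^ k * x ^ m / qpochhammer q q (enat m))
        = real m ^ k * norm x ^ m * norm (1 / qpochhammer q q (enat m))"
      by (simp add: norm_mult norm_power norm_divide)
    also have "\<dots> \<le> real m ^ k * norm x ^ m * K"
      by (intro mult_left_mono K) auto
    finally show "norm (norm (of_nat m ^ k * x ^ m / qpochhammer q q (enat m)))
        \<le> real m ^ k * norm x ^ m * K" by simp
  qed
qed

text \<open>Restates \<open>S\<close> as an absolutely convergent series over all naturals, as the
  Cauchy product requires.\<close>

lemma S_eq_suminf:
  assumes q: "norm q < 1" and n: "n \<ge> 1"
  shows "summable (\<lambda>m. norm (of_nat m ^ j * q ^ (n * m) / (1 - q ^ m)))"
    and "S j n q = (\<Sum>m. of_nat m ^ j * q ^ (n * m) / (1 - q ^ m))"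
proof -
  let ?g = "\<lambda>m. of_nat m ^ j * q ^ (n * m) / (1 - q ^ m)"
  show sm: "summable (\<lambda>m. norm (?g m))"
  proof (rule summable_comparison_test'[OF summable_S_bound[OF q, of j], of 1])
    show "norm (norm (?g m)) \<le> real m ^ j * norm q ^ m / (1 - norm q)" if "m \<ge> 1" for m
      using S_term_bound[OF q n that, of j] by simp
  qed
  have "S j n q = infsum ?g UNIV"
    unfolding S_def
  proof (rule infsum_cong_neutral)
    \<comment> \<open>For \<open>j = 0\<close> the numerator at \<open>m = 0\<close> is 1, so the
      added term vanishes only by the convention \<open>1 / 0 = 0\<close>.\<close>
    fix m :: nat assume "m \<in> UNIV - {1..}"
    hence "m = 0" by auto
    thus "?g m = 0" by simp
  qed auto
  also have "\<dots> = suminf ?g"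
    using norm_summable_imp_has_sum[OF sm summable_sums[OF summable_norm_cancel[OF sm]]]
    by (rule infsumI)
  finally show "S j n q = suminf ?g" .
qed

text \<open>Each product on the right is a Cauchy product. In its coefficient of index
  \<open>m\<close>, the binomial theorem collapses the sum over \<open>j\<close> to
  \<open>m ^ k\<close>, and \<open>inverse_qpochhammer_log_deriv\<close> supplies the remaining
  factor \<open>m\<close>. This is the recurrence of \<open>complete_bell_Suc\<close> with
  \<open>a (Suc j) = S j n q\<close>.\<close>

lemma power_qpochhammer_suminf_Suc:
  assumes q: "norm q < 1" and n: "n \<ge> 1"
  defines "T \<equiv> \<lambda>k. \<Sum>m. of_nat m ^ k * (q ^ n) ^ m / qpochhammer q q (enat m)"
  shows "T (Suc k) = (\<Sum>j\<le>k. of_nat (k choose j) * S j n q * T (k - j))"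
proof -
  define s where "s = (\<lambda>j m. of_nat m ^ j * q ^ (n * m) / (1 - q ^ m))"
  define t where "t = (\<lambda>j m. of_nat m ^ j * (q ^ n) ^ m / qpochhammer q q (enat m))"
  have "norm (q ^ n) < 1" using q n by (simp add: norm_power power_less_one_iff)
  hence t: "summable (\<lambda>m. norm (t j m))" for j
    unfolding t_def by (intro summable_norm_power_qpochhammer q)
  have s: "summable (\<lambda>m. norm (s j m))" for j
    unfolding s_def by (rule S_eq_suminf[OF q n])
  have "(\<lambda>m. \<Sum>i\<le>m. s j i * t (k - j) (m - i)) sums (S j n q * T (k - j))" for j
    using Cauchy_product_sums[OF s t] S_eq_suminf(2)[OF q n] by (simp add: s_def t_def T_def)
  hence "(\<lambda>m. \<Sum>j\<le>k. of_nat (k choose j) * (\<Sum>i\<le>m. s j i * t (k - j) (m - i)))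
      sums (\<Sum>j\<le>k. of_nat (k choose j) * (S j n q * T (k - j)))"
    by (intro sums_sum sums_mult)
  also have "(\<lambda>m. \<Sum>j\<le>k. of_nat (k choose j) * (\<Sum>i\<le>m. s j i * t (k - j) (m - i))) = t (Suc k)"
  proof
    fix m
    have "(\<Sum>j\<le>k. of_nat (k choose j) * (\<Sum>i\<le>m. s j i * t (k - j) (m - i)))
        = (\<Sum>i\<le>m. \<Sum>j\<le>k. of_nat (k choose j) * (s j i * t (k - j) (m - i)))"
      unfolding sum_distrib_left by (rule sum.swap)
    also have "\<dots> = (\<Sum>i\<le>m. of_nat m ^ k * (q ^ n) ^ m
                      * (1 / (1 - q ^ i) * (1 / qpochhammer q q (enat (m - i)))))"
    proof (rule sum.cong[OF refl])
      fix i assume "i \<in> {..m}"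
      hence i: "i + (m - i) = m" by simp
      have qq: "q ^ (n * i) * (q ^ n) ^ (m - i) = (q ^ n) ^ m"
        by (metis i power_add power_mult)
      have "(\<Sum>j\<le>k. of_nat (k choose j) * (s j i * t (k - j) (m - i)))
          = (\<Sum>j\<le>k. of_nat (k choose j) * of_nat i ^ j * of_nat (m - i) ^ (k - j))
            * ((q ^ (n * i) * (q ^ n) ^ (m - i))
            * (1 / (1 - q ^ i) * (1 / qpochhammer q q (enat (m - i)))))"
        unfolding sum_distrib_right by (intro sum.cong refl) (simp add: s_def t_def)
      also have "(\<Sum>j\<le>k. of_nat (k choose j) * of_nat i ^ j * of_nat (m - i) ^ (k - j))
          = (of_nat m :: complex) ^ k"
        using binomial_ring[of "of_nat i :: complex" "of_nat (m - i)" k] i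
        by (metis of_nat_add)
      finally show "(\<Sum>j\<le>k. of_nat (k choose j) * (s j i * t (k - j) (m - i)))
          = of_nat m ^ k * (q ^ n) ^ m * (1 / (1 - q ^ i) * (1 / qpochhammer q q (enat (m - i))))"
        unfolding qq by (simp only: mult.assoc)
    qed
    also have "\<dots> = t (Suc k) m"
      unfolding sum_distrib_left[symmetric] inverse_qpochhammer_log_deriv[OF q]
      by (simp add: t_def)
    finally show "(\<Sum>j\<le>k. of_nat (k choose j) * (\<Sum>i\<le>m. s j i * t (k - j) (m - i))) = t (Suc k) m" .
  qed
  finally have "t (Suc k) sums (\<Sum>j\<le>k. of_nat (k choose j) * S j n q * T (k - j))"
    by (simp add: mult.assoc)
  thus ?thesis unfolding T_def t_def by (rule sums_unique[symmetric])
qed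

text \<open>Strong induction, since the shared recurrence reaches back to all smaller indices. The
  case \<open>k = 0\<close> is Euler's reciprocal identity at \<open>q ^ n\<close>.\<close>

lemma bell_S_eq_suminf:
  assumes q: "norm q < 1" and n: "n \<ge> 1"
  shows "bell_S k n q = qpochhammer (q ^ n) q \<infinity> *
           (\<Sum>m. of_nat m ^ k * (q ^ n) ^ m / qpochhammer q q (enat m))"
proof (induction k rule: less_induct)
  case (less k)
  have x: "norm (q ^ n) < 1" using q n by (simp add: norm_power power_less_one_iff)
  show ?case
  proof (cases k)
    case 0
    have "(\<Sum>m. (q ^ n) ^ m / qpochhammer q q (enat m)) = 1 / qpochhammer (q ^ n) q \<infinity>"
      by (rule sums_unique[OF euler_reciprocal_sums(1)[OF q x], symmetric])
    thus ?thesis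
      unfolding 0 bell_S_def complete_bell_0 power_0 mult_1
      using euler_reciprocal_sums(2)[OF q x]
      by (metis nonzero_mult_div_cancel_left times_divide_eq_right mult_1_right)
  next
    case (Suc l)
    have "bell_S k n q = (\<Sum>j\<le>l. of_nat (l choose j) * S j n q * bell_S (l - j) n q)"
      unfolding bell_S_def Suc complete_bell_Suc by simp
    also have "\<dots> = (\<Sum>j\<le>l. of_nat (l choose j) * S j n q * (qpochhammer (q ^ n) q \<infinity> *
        (\<Sum>m. of_nat m ^ (l - j) * (q ^ n) ^ m / qpochhammer q q (enat m))))"
      by (intro sum.cong refl) (simp add: less Suc)
    finally show ?thesis
      unfolding Suc power_qpochhammer_suminf_Suc[OF q n] sum_distrib_left
      by (simp add: mult_ac)
  qed
qed

section \<open>Exchange of summation in the double series\<close>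

theorem theorem6p2:
  fixes k :: nat and q :: complex
  assumes "norm q < 1"
  shows "MU k q =
    1 / qpochhammer q q \<infinity> ^ 2 *
      (\<Sum>\<^sub>\<infinity>n. (-1) ^ n * q ^ (n * (n + 1) div 2) * bell_S k (n + 1) q)"
proof -
  note q = assms
  define P where "P = qpochhammer q q \<infinity>"
  define p where "p = (\<lambda>m. qpochhammer q q (enat m))"
  \<comment> \<open>Chosen so that, up to the factor \<open>P\<close>, row sums over
    \<open>m\<close> are the summands of the Bell series, while column sums over \<open>n\<close>
    are \<open>P\<close> times the summands of \<open>MU k q\<close>.\<close>
  define h where "h = (\<lambda>n m. (-1) ^ n * q ^ (n * (n + 1) div 2) / p n *
      (of_nat m ^ k * (q ^ Suc n) ^ m / p m))"
  have P: "P \<noteq> 0" unfolding P_def by (rule qpochhammer_infinity_nonzero[OF q])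
  have p: "p n \<noteq> 0" for n unfolding p_def by (rule qpochhammer_nonzero[OF q q])
  have tail: "qpochhammer (q ^ Suc n) q \<infinity> = P / p n" for n
    using qpochhammer_infinity_split[OF q, of q n] p[of n] by (simp add: P_def p_def)
  have x: "norm (q ^ Suc n) < 1" for n
    using q power_decreasing[of 1 "Suc n" "norm q"] by (auto simp: norm_power simp del: power_Suc)
  obtain K where K: "K > 0" "\<And>m. norm (1 / p m) \<le> K"
    using inverse_qpochhammer_bounded[OF q] unfolding p_def by metis

  have row: "((\<lambda>m. of_nat m ^ k * (q ^ Suc n) ^ m / p m) has_sum
      (\<Sum>m. of_nat m ^ k * (q ^ Suc n) ^ m / p m)) UNIV" for n
    using summable_norm_power_qpochhammer[OF q x] unfolding p_def
    by (blast intro: norm_summable_imp_has_sum summable_sums summable_norm_cancel)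
  have bell: "(-1) ^ n * q ^ (n * (n + 1) div 2) * bell_S k (n + 1) q = P * (\<Sum>\<^sub>\<infinity>m. h n m)" for n
  proof -
    have "(\<Sum>\<^sub>\<infinity>m. h n m) = (-1) ^ n * q ^ (n * (n + 1) div 2) / p n *
        (\<Sum>m. of_nat m ^ k * (q ^ Suc n) ^ m / p m)"
      unfolding h_def by (intro infsumI has_sum_cmult_right row)
    thus ?thesis
      using bell_S_eq_suminf[OF q, of "Suc n" k] tail[of n] by (simp add: p_def)
  qed

  have column: "(\<Sum>\<^sub>\<infinity>n. h n m) = P * (of_nat m ^ k * q ^ m / p m ^ 2)" for m
  proof -
    let ?e = "\<lambda>n. (-1) ^ n * q ^ (n * (n - 1) div 2) * (q ^ Suc m) ^ n / p n"
    \<comment> \<open>Euler's identity at \<open>q ^ Suc m\<close> has exponent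
      \<open>n(n-1)/2 + (m+1)n\<close>; moving one \<open>n\<close> into the triangular number gives
      the exponent occurring in \<open>h\<close>.\<close>
    have e: "?e n = (-1) ^ n * q ^ (n * (n + 1) div 2) * q ^ (n * m) / p n" for n
    proof -
      have "n * (n - 1) div 2 + Suc m * n = n * (n + 1) div 2 + n * m"
        by (cases n) (auto simp: algebra_simps)
      hence "q ^ (n * (n - 1) div 2) * (q ^ Suc m) ^ n = q ^ (n * (n + 1) div 2) * q ^ (n * m)"
        by (simp only: flip: power_mult power_add)
      thus ?thesis by (simp only: mult.assoc)
    qed
    have sm: "summable (\<lambda>n. norm (?e n))"
    proof (rule summable_comparison_test')
      show "summable (\<lambda>n. norm (q ^ Suc m) ^ n * K)"
        using x by (intro summable_mult2 summable_geometric) simp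
      fix n
      have "norm (?e n) = norm q ^ (n * (n - 1) div 2) * (norm (q ^ Suc m) ^ n * norm (1 / p n))"
        by (simp add: norm_mult norm_power norm_divide)
      also have "\<dots> \<le> 1 * (norm (q ^ Suc m) ^ n * K)"
        using q K by (intro mult_mono power_le_one) auto
      finally show "norm (norm (?e n)) \<le> norm (q ^ Suc m) ^ n * K" by simp
    qed
    have "?e sums (P / p m)"
      using euler_sums[OF q x[of m]] by (simp only: p_def tail)
    hence "(?e has_sum (P / p m)) UNIV" by (rule norm_summable_imp_has_sum[OF sm])
    hence "((\<lambda>n. of_nat m ^ k * q ^ m / p m * ?e n) has_sum
        (of_nat m ^ k * q ^ m / p m * (P / p m))) UNIV"
      by (rule has_sum_cmult_right)
    moreover have "of_nat m ^ k * q ^ m / p m * ?e n = h n m" for n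
    proof -
      have "(q ^ Suc n) ^ m = q ^ m * q ^ (n * m)"
        by (simp add: power_mult_distrib power_mult)
      thus ?thesis unfolding e h_def by (simp add: mult_ac)
    qed
    ultimately have "((\<lambda>n. h n m) has_sum (of_nat m ^ k * q ^ m / p m * (P / p m))) UNIV" by simp
    thus ?thesis by (intro infsumI) (simp add: power2_eq_square mult_ac)
  qed

  \<comment> \<open>From \<open>n \<le> n(n+1)/2\<close> and \<open>m \<le> (n+1)m\<close> the
    double series has a product majorant: a geometric series in \<open>n\<close> times
    \<open>m ^ k * norm q ^ m\<close>, with one factor \<open>K\<close> for each reciprocal
    Pochhammer symbol.\<close>
  have "(\<lambda>(n, m). h n m) summable_on UNIV \<times> UNIV"
  proof -
    have 1: "(\<lambda>n. norm q ^ n) summable_on UNIV"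
      using q by (intro norm_summable_imp_summable_on) (auto intro: summable_geometric)
    have 2: "(\<lambda>m. real m ^ k * norm q ^ m) summable_on UNIV"
      using summable_power_geometric[of "norm q" k] q by (intro norm_summable_imp_summable_on) auto
    have "(\<lambda>(n, m). norm q ^ n * (real m ^ k * norm q ^ m)) summable_on UNIV \<times> UNIV"
    proof (rule summable_on_SigmaI)
      show "((\<lambda>m. case (n, m) of (n, m) \<Rightarrow> norm q ^ n * (real m ^ k * norm q ^ m)) has_sum
          norm q ^ n * (\<Sum>\<^sub>\<infinity>m. real m ^ k * norm q ^ m)) UNIV" for n
        using has_sum_cmult_right[OF has_sum_infsum[OF 2]] by simp
      show "(\<lambda>n. norm q ^ n * (\<Sum>\<^sub>\<infinity>m. real m ^ k * norm q ^ m)) summable_on UNIV"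
        by (rule summable_on_cmult_left[OF 1])
    qed auto
    hence "(\<lambda>z. (case z of (n, m) \<Rightarrow> norm q ^ n * (real m ^ k * norm q ^ m)) * K\<^sup>2)
        summable_on UNIV \<times> UNIV"
      by (rule summable_on_cmult_left)
    hence "(\<lambda>z. norm (case z of (n, m) \<Rightarrow> h n m)) summable_on UNIV \<times> UNIV"
    proof (rule summable_on_comparison_test)
      fix z :: "nat \<times> nat"
      obtain n m where z: "z = (n, m)" by force
      have "n \<le> n * (n + 1) div 2" by (cases n) auto
      hence 3: "norm q ^ (n * (n + 1) div 2) \<le> norm q ^ n"
        using q by (intro power_decreasing) auto
      have "m \<le> Suc n * m" by simp
      hence 4: "norm q ^ (Suc n * m) \<le> norm q ^ m"
        using q by (intro power_decreasing) auto
      have "norm (h n m) = norm q ^ (n * (n + 1) div 2) * norm (1 / p n)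
          * (real m ^ k * norm q ^ (Suc n * m) * norm (1 / p m))"
        by (simp only: h_def norm_mult norm_power norm_divide norm_of_nat norm_one norm_minus_cancel
            power_one mult_1 power_mult times_divide_eq_right mult_1_right)
      also have "\<dots> \<le> norm q ^ n * K * (real m ^ k * norm q ^ m * K)"
        using K by (intro mult_mono 3 4) auto
      finally show "norm (case z of (n, m) \<Rightarrow> h n m)
          \<le> (case z of (n, m) \<Rightarrow> norm q ^ n * (real m ^ k * norm q ^ m)) * K\<^sup>2"
        by (simp add: z power2_eq_square mult_ac)
    qed (rule norm_ge_zero)
    thus ?thesis by (rule abs_summable_summable)
  qed
  hence "(\<Sum>\<^sub>\<infinity>n. \<Sum>\<^sub>\<infinity>m. h n m) = (\<Sum>\<^sub>\<infinity>m. \<Sum>\<^sub>\<infinity>n. h n m)"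
    by (rule infsum_swap_banach)
  also have "\<dots> = P * MU k q"
    unfolding column MU_def p_def by (rule infsum_cmult_right')
  \<comment> \<open>One factor \<open>P\<close> comes from the rows and one from the columns, hence
    the square.\<close>
  finally have "(\<Sum>\<^sub>\<infinity>n. (-1) ^ n * q ^ (n * (n + 1) div 2) * bell_S k (n + 1) q) = P ^ 2 * MU k q"
    unfolding bell infsum_cmult_right' by (simp add: power2_eq_square)
  thus ?thesis using P by (simp add: P_def)
qed

end
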